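(* Let $\mathbb{H}$ be a real separable Hilbert space with orthonormal basis $(e_i)_{i\ge1}$ and $(\mu_{t,s})_{t\ge s}$ Borel probability measures on $\mathbb{H}$ with $\mu_{t,s}=\mu_{t,r}*\mu_{r,s}$ for all $t\ge r\ge s$, such that $\mu_{t,s}\Rightarrow\delta_0$ as $t\downarrow s$ (each fixed $s$) and as $s\uparrow t$ (each fixed $t$); then each $\mu_{t,s}$ is infinitely divisible, $\mu_{t,s}=[a_{t,s},R_{t,s},m_{t,s}]$. Suppose that $(\mu_{t,s})_{t\ge s}$ is natural and that $\tilde\gamma(A):=\sum_{i=1}^\infty|a|_{\mathrm{var}}(e_i,A)<\infty$ for every bounded Borel $A\subset\mathbb{R}$. Let $\mu_A$, $\psi_A$, $\tilde\pi$, $\tilde h^{(1)},\tilde h^{(2)},\tilde h^{(3)}$, $b$, $K$, $J$ and $\rho_s$ be as defined in the context. Then for all bounded Borel $A\subset\mathbb{R}$, $$\hat\mu_A(\xi)=\exp(-\psi_A(\xi))=\exp\Bigl(-\int_A\rho_s(\xi)\,\tilde\pi(ds)\Bigr),\qquad\xi\in\mathbb{H};$$ in other words, $$\mu_A=\Bigl[\int_A b(s)\tilde h^{(1)}(s)\,\tilde\pi(ds),\ \int_A K(s)\tilde h^{(2)}(s)\,\tilde\pi(ds),\ \int_A\tilde h^{(3)}(s)J(s,\cdot)\,\tilde\pi(ds)\Bigr].$$ In particular, for all $s\le t$, $$\hat\mu_{t,s}(\xi)=\exp\Bigl(-\int_s^t\rho_r(\xi)\,\tilde\pi(dr)\Bigr),\qquad\xi\in\mathbb{H},$$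 and $$\mu_{t,s}=\Bigl[\int_s^t b(r)\tilde h^{(1)}(r)\,\tilde\pi(dr),\ \int_s^t K(r)\tilde h^{(2)}(r)\,\tilde\pi(dr),\ \int_s^t\tilde h^{(3)}(r)J(r,\cdot)\,\tilde\pi(dr)\Bigr].$$
   Context: $\Rightarrow$ is weak convergence; $\hat\mu(\xi)=\int e^{i\langle x,\xi\rangle}\mu(dx)$. $\mu=[a,R,m]$ means that $\mu$ is infinitely divisible with $\hat\mu=e^{-\psi}$, $\psi(\xi)=-i\langle a,\xi\rangle+\frac12\langle R\xi,\xi\rangle-\int_{\mathbb{H}}\bigl(e^{i\langle\xi,x\rangle}-1-\frac{i\langle\xi,x\rangle}{1+|x|^2}\bigr)m(dx)$, where $a\in\mathbb{H}$, $R$ is a non-negative symmetric trace class operator and $m$ is a Lévy measure (a $\sigma$-finite measure on $\mathbb{H}\setminus\{0\}$ with $\int(1\wedge|x|^2)\,dm<\infty$). $(\mu_{t,s})$ is natural if for all $\xi\in\mathbb{H}$, $t\in\mathbb{R}$, $s\mapsto\langle a_{t,s},\xi\rangle$ is of bounded variation on every finite subinterval of $(-\infty,t]$. For bounded Borel $A\subset\mathbb{R}$, $a(A)\in\mathbb{H}$, $R(A)$ (non-negative self-adjoint trace class operator) and $m(A,\cdot)$ (Lévy measure) denote the unique countably additive set functions (in the sense that $a(\xi,\cdot):=\langle a(\cdot),\xi\rangle$, $\langle R(\cdot)\xi,\xi\rangle$ and $m(\cdot,B)$ are countably additive for each $\xi\in\mathbb{H}$ and Borel $B\subset\mathbb{H}$)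 with $a((s,t])=a_{t,s}$, $R((s,t])=R_{t,s}$, $m((s,t],\cdot)=m_{t,s}$ for $s\le t$. $|a|_{\mathrm{var}}(\xi,\cdot)$ is the total variation measure of the (locally finite) signed measure $a(\xi,\cdot)$. Put $\mu_A=[a(A),R(A),m(A,\cdot)]$ with characteristic exponent $\psi_A=-\log\hat\mu_A$; then $\mu_{(s,t]}=\mu_{t,s}$. Put $\tilde\pi_R(A)=\operatorname{tr}R(A)$ and $\tilde F(A)=\int_{\mathbb{H}}(1\wedge|x|^2)\,m(A,dx)$. $K(s)$, $s\in\mathbb{R}$, are non-negative self-adjoint trace class operators, measurable in $s$, with $R(A)=\int_A K(s)\,\tilde\pi_R(ds)$ for bounded Borel $A$. $J(s,\cdot)$, $s\in\mathbb{R}$, are Lévy measures, $s\mapsto J(s,B)$ measurable for Borel $B$, with $\int_{\mathbb{H}}f(x)\,m(A,dx)=\int_A\int_{\mathbb{H}}f(x)\,J(s,dx)\,\tilde F(ds)$ for Borel $f\ge0$ and bounded Borel $A$. $b:\mathbb{R}\to\mathbb{H}$ is measurable with $a(A)=\int_A b(s)\,\tilde\gamma(ds)$ for bounded Borel $A$ (such $b$ exists under the stated assumption on $\tilde\gamma$). $\tilde\pi=\tilde\gamma+\tilde\pi_R+\tilde F$, $\tilde h^{(1)}=d\tilde\gamma/d\tilde\pi$, $\tilde h^{(2)}=d\tilde\pi_R/d\tilde\pi$, $\tilde h^{(3)}=d\tilde F/d\tilde\pi$, and $$\rho_s(\xi)=-i\langle b(s)\tilde h^{(1)}(s),\xi\rangle+\tfrac12\langle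 K(s)\tilde h^{(2)}(s)\xi,\xi\rangle-\int_{\mathbb{H}\setminus\{0\}}\Bigl(e^{i\langle\xi,x\rangle}-1-\frac{i\langle\xi,x\rangle}{1+|x|^2}\Bigr)\tilde h^{(3)}(s)\,J(s,dx).$$ *)

theory Defs
  imports "HOL-Probability.Probability"
begin

text \<open>A real separable Hilbert space is a type of sort
  \<open>{real_inner, banach, second_countable_topology}\<close>.\<close>

text \<open>The index set \<open>I\<close> makes it possible to cover finite-dimensional spaces too; the
  infinite-dimensional case is \<open>I = UNIV\<close> (or any other infinite \<open>I\<close>).\<close>

definition orthonormal_basis :: "nat set \<Rightarrow> (nat \<Rightarrow> 'a::real_inner) \<Rightarrow> bool" where
  "orthonormal_basis I e \<longleftrightarrow>
     (\<forall>i\<in>I. \<forall>j\<in>I. e i \<bullet> e j = (if i = j then 1 else 0)) \<and> closure (span (e ` I)) = UNIV"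

definition borel_prob :: "'a::topological_space measure \<Rightarrow> bool" where
  "borel_prob \<mu> \<longleftrightarrow> prob_space \<mu> \<and> sets \<mu> = sets borel"

text \<open>Same definition as \<^const>\<open>convolution\<close>, whose type is restricted to Euclidean spaces.\<close>

definition hconv :: "'a::{real_inner, banach, second_countable_topology} measure
    \<Rightarrow> 'a measure \<Rightarrow> 'a measure" where
  "hconv M N = distr (M \<Otimes>\<^sub>M N) borel (\<lambda>(x, y). x + y)"

primrec hconv_power :: "'a::{real_inner, banach, second_countable_topology} measure
    \<Rightarrow> nat \<Rightarrow> 'a measure" where
  "hconv_power M 0 = return borel 0"
| "hconv_power M (Suc n) = hconv (hconv_power M n) M"

definition infinitely_divisible ::
    "'a::{real_inner, banach, second_countable_topology} measure \<Rightarrow> bool" where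
  "infinitely_divisible \<mu> \<longleftrightarrow> borel_prob \<mu> \<and>
     (\<forall>n\<ge>1. \<exists>\<nu>. borel_prob \<nu> \<and> \<mu> = hconv_power \<nu> n)"

definition weakly_converges ::
    "('b \<Rightarrow> 'a::topological_space measure) \<Rightarrow> 'a measure \<Rightarrow> 'b filter \<Rightarrow> bool" where
  "weakly_converges M N F \<longleftrightarrow>
     (\<forall>f::'a \<Rightarrow> real. continuous_on UNIV f \<longrightarrow> bounded (range f) \<longrightarrow>
        ((\<lambda>t. LINT x|M t. f x) \<longlongrightarrow> (LINT x|N. f x)) F)"

definition char_fun :: "'a::real_inner measure \<Rightarrow> 'a \<Rightarrow> complex" where
  "char_fun \<mu> \<xi> = (CLINT x|\<mu>. iexp (x \<bullet> \<xi>))"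

text \<open>Non-negative symmetric trace class operators. For a non-negative operator, trace class means
  that the diagonal series with respect to orthonormal bases converges.\<close>

definition nonneg_trace_class :: "('a::real_inner \<Rightarrow> 'a) \<Rightarrow> bool" where
  "nonneg_trace_class R \<longleftrightarrow> bounded_linear R \<and> (\<forall>x y. R x \<bullet> y = x \<bullet> R y) \<and> (\<forall>x. 0 \<le> R x \<bullet> x) \<and>
     (\<forall>I e. orthonormal_basis I e \<longrightarrow> (\<lambda>i. R (e i) \<bullet> e i) summable_on I)"

definition op_trace :: "nat set \<Rightarrow> (nat \<Rightarrow> 'a::real_inner) \<Rightarrow> ('a \<Rightarrow> 'a) \<Rightarrow> real" where
  "op_trace I e R = (\<Sum>\<^sub>\<infinity>i\<in>I. R (e i) \<bullet> e i)"

text \<open>Measures on \<open>H - {0}\<close> are represented as measures on \<open>H\<close> without mass at \<open>0\<close>.\<close>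

definition levy_measure :: "'a::real_normed_vector measure \<Rightarrow> bool" where
  "levy_measure m \<longleftrightarrow> sets m = sets borel \<and> sigma_finite_measure m \<and> emeasure m {0} = 0 \<and>
     (\<integral>\<^sup>+x. ennreal (min 1 ((norm x)\<^sup>2)) \<partial>m) < \<infinity>"

definition levy_integrand :: "'a::real_inner \<Rightarrow> 'a \<Rightarrow> complex" where
  "levy_integrand \<xi> x =
     iexp (\<xi> \<bullet> x) - 1 - \<i> * of_real (\<xi> \<bullet> x) / of_real (1 + (norm x)\<^sup>2)"

definition levy_exponent :: "'a::real_inner \<Rightarrow> ('a \<Rightarrow> 'a) \<Rightarrow> 'a measure \<Rightarrow> 'a \<Rightarrow> complex" where
  "levy_exponent a R m \<xi> = - \<i> * of_real (a \<bullet> \<xi>) + of_real (R \<xi> \<bullet> \<xi>) / 2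
     - (CLINT x|m. levy_integrand \<xi> x)"

text \<open>\<open>has_triplet \<mu> a R m\<close> stands for \<open>\<mu> = [a, R, m]\<close>.\<close>

definition has_triplet :: "'a::{real_inner, banach, second_countable_topology} measure
    \<Rightarrow> 'a \<Rightarrow> ('a \<Rightarrow> 'a) \<Rightarrow> 'a measure \<Rightarrow> bool" where
  "has_triplet \<mu> a R m \<longleftrightarrow> infinitely_divisible \<mu> \<and> nonneg_trace_class R \<and> levy_measure m \<and>
     (\<forall>\<xi>. char_fun \<mu> \<xi> = exp (- levy_exponent a R m \<xi>))"

definition bounded_variation_on :: "(real \<Rightarrow> real) \<Rightarrow> real \<Rightarrow> real \<Rightarrow> bool" where
  "bounded_variation_on f c d \<longleftrightarrow>
     (\<exists>C. \<forall>(n::nat) (x::nat \<Rightarrow> real).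
        mono_on {..n} x \<longrightarrow> x ` {..n} \<subseteq> {c..d} \<longrightarrow> (\<Sum>i<n. \<bar>f (x (Suc i)) - f (x i)\<bar>) \<le> C)"

definition bounded_borel :: "real set \<Rightarrow> bool" where
  "bounded_borel A \<longleftrightarrow> A \<in> sets borel \<and> bounded A"

text \<open>Set functions below are only meaningful on bounded Borel sets, so countable additivity is
  required for sequences whose union is still bounded.\<close>

definition loc_countably_additive ::
    "(real set \<Rightarrow> 'b::{comm_monoid_add, topological_space}) \<Rightarrow> bool" where
  "loc_countably_additive \<phi> \<longleftrightarrow>
     (\<forall>A::nat \<Rightarrow> real set. (\<forall>i. bounded_borel (A i)) \<longrightarrow> disjoint_family A \<longrightarrow> bounded (\<Union>i. A i) \<longrightarrow>
        (\<lambda>i. \<phi> (A i)) sums \<phi> (\<Union>i. A i))"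

text \<open>Total variation, on a bounded Borel set, of a locally finite signed measure.\<close>

definition total_variation :: "(real set \<Rightarrow> real) \<Rightarrow> real set \<Rightarrow> ennreal" where
  "total_variation \<nu> A =
     (SUP P\<in>{P. finite P \<and> disjoint P \<and> P \<subseteq> sets borel \<and> \<Union>P = A}. \<Sum>B\<in>P. ennreal \<bar>\<nu> B\<bar>)"

text \<open>The Borel measure on the real line with values \<open>\<phi> A\<close> on the bounded Borel sets \<open>A\<close>.\<close>

definition borel_extension :: "(real set \<Rightarrow> ennreal) \<Rightarrow> real measure" where
  "borel_extension \<phi> =
     measure_of UNIV (sets borel) (\<lambda>A. SUP n::nat. \<phi> (A \<inter> {- real n..real n}))"

definition gamma_fun ::
    "nat set \<Rightarrow> (nat \<Rightarrow> 'a::real_inner) \<Rightarrow> (real set \<Rightarrow> 'a) \<Rightarrow> real set \<Rightarrow> ennreal" where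
  "gamma_fun I e a A = (\<Sum>\<^sub>\<infinity>i\<in>I. total_variation (\<lambda>B. a B \<bullet> e i) A)"

definition gamma_measure ::
    "nat set \<Rightarrow> (nat \<Rightarrow> 'a::real_inner) \<Rightarrow> (real set \<Rightarrow> 'a) \<Rightarrow> real measure" where
  "gamma_measure I e a = borel_extension (gamma_fun I e a)"

definition piR_measure ::
    "nat set \<Rightarrow> (nat \<Rightarrow> 'a::real_inner) \<Rightarrow> (real set \<Rightarrow> 'a \<Rightarrow> 'a) \<Rightarrow> real measure" where
  "piR_measure I e R = borel_extension (\<lambda>A. ennreal (op_trace I e (R A)))"

definition F_measure :: "(real set \<Rightarrow> 'a::real_normed_vector measure) \<Rightarrow> real measure" where
  "F_measure m = borel_extension (\<lambda>A. \<integral>\<^sup>+x. ennreal (min 1 ((norm x)\<^sup>2)) \<partial>m A)"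

definition add_measures3 :: "real measure \<Rightarrow> real measure \<Rightarrow> real measure \<Rightarrow> real measure" where
  "add_measures3 M1 M2 M3 =
     measure_of UNIV (sets borel) (\<lambda>A. emeasure M1 A + emeasure M2 A + emeasure M3 A)"

text \<open>\<open>h\<close> is a version of the Radon-Nikodym derivative \<open>dN/dM\<close>.\<close>

definition is_RN_deriv :: "real measure \<Rightarrow> real measure \<Rightarrow> (real \<Rightarrow> real) \<Rightarrow> bool" where
  "is_RN_deriv M N h \<longleftrightarrow>
     h \<in> borel_measurable borel \<and> (\<forall>s. 0 \<le> h s) \<and> density M (\<lambda>s. ennreal (h s)) = N"

text \<open>The measure \<open>\<integral>\<^sub>A h(s) J(s, \<cdot>) M(ds)\<close>.\<close>

definition kernel_integral ::
    "real measure \<Rightarrow> real set \<Rightarrow> (real \<Rightarrow> real) \<Rightarrow> (real \<Rightarrow> 'a::topological_space measure)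
      \<Rightarrow> 'a measure" where
  "kernel_integral M A h J =
     measure_of UNIV (sets borel) (\<lambda>B. \<integral>\<^sup>+s\<in>A. ennreal (h s) * emeasure (J s) B \<partial>M)"

definition rho :: "(real \<Rightarrow> 'a::real_inner) \<Rightarrow> (real \<Rightarrow> 'a \<Rightarrow> 'a) \<Rightarrow> (real \<Rightarrow> 'a measure)
    \<Rightarrow> (real \<Rightarrow> real) \<Rightarrow> (real \<Rightarrow> real) \<Rightarrow> (real \<Rightarrow> real) \<Rightarrow> real \<Rightarrow> 'a \<Rightarrow> complex" where
  "rho b K J h1 h2 h3 s \<xi> =
     - \<i> * of_real ((h1 s *\<^sub>R b s) \<bullet> \<xi>) + of_real ((h2 s *\<^sub>R K s \<xi>) \<bullet> \<xi>) / 2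
     - (CLINT x:- {0}|J s. levy_integrand \<xi> x * of_real (h3 s))"

end

theory Submission
  imports Defs
begin

text \<open>
  The exponent of \<open>[a(A), R(A), m(A, \<cdot>)]\<close> depends linearly on the triplet, and each of the three
  entries is an integral over \<open>A\<close>: of \<open>b\<close> against \<open>\<gamma>\<close>, of \<open>K\<close> against \<open>\<pi>\<^sub>R\<close>, and of the
  kernel \<open>J\<close> against \<open>F\<close>. Since \<open>\<gamma>\<close>, \<open>\<pi>\<^sub>R\<close> and \<open>F\<close> have the densities \<open>h1\<close>, \<open>h2\<close> and \<open>h3\<close>
  with respect to \<open>\<pi>\<close>, all three become integrals against the single measure \<open>\<pi>\<close>
  (\<open>set_integral_RN_deriv\<close>, \<open>kernel_integral_eq\<close>). This yields the representation of the
  triplet. Pairing the first two entries with \<open>\<xi>\<close> and pulling the pairing under the integral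
  sign gives the drift and the Gaussian part of \<open>\<integral>\<^sub>A \<rho>\<^sub>s(\<xi>) \<pi>(ds)\<close>.

  The jump part is where an argument is needed: the disintegration of \<open>m(A, \<cdot>)\<close> into the measures
  \<open>J(s, \<cdot>)\<close> is given for non-negative functions, whereas the Levy integrand is complex
  and the measures involved may be infinite. It extends to functions that are integrable with
  respect to \<open>m(A, \<cdot>)\<close> and every \<open>J(s, \<cdot>)\<close> by splitting into positive and negative, real and
  imaginary parts (\<open>kernel_disintegration_complex\<close>), and the Levy integrand is such a
  function because it is dominated by a multiple of \<open>min 1 (|x|\<^sup>2)\<close> (\<open>norm_levy_integrand_le\<close>).
\<close>

section \<open>Change of the reference measure\<close>

lemma sets_add_measures3: "sets (add_measures3 M1 M2 M3) = sets borel"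
  by (simp add: add_measures3_def sets.sigma_sets_eq[of borel, simplified])

lemma set_integral_RN_deriv:
  fixes f :: "real \<Rightarrow> 'b::{banach, second_countable_topology}"
  assumes h: "is_RN_deriv M N h" and M: "sets M = sets borel" and A: "A \<in> sets borel"
    and f: "f \<in> borel_measurable borel" and int: "set_integrable N A f"
  shows "set_integrable M A (\<lambda>s. h s *\<^sub>R f s)"
    and "(LINT s:A|M. h s *\<^sub>R f s) = (LINT s:A|N. f s)"
proof -
  have N: "N = density M (\<lambda>s. ennreal (h s))" and h0: "AE s in M. 0 \<le> h s"
    and hm: "h \<in> borel_measurable M"
    using h M by (auto simp: is_RN_deriv_def cong: measurable_cong_sets)
  have g: "(\<lambda>s. indicator A s *\<^sub>R f s) \<in> borel_measurable M"
    using f A by (simp add: measurable_cong_sets[OF M refl])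
  have comm: "indicator A s *\<^sub>R h s *\<^sub>R f s = h s *\<^sub>R indicator A s *\<^sub>R f s" for s
    by (simp add: mult.commute)
  show "set_integrable M A (\<lambda>s. h s *\<^sub>R f s)"
    using int unfolding set_integrable_def N comm integrable_density[OF g hm h0] .
  show "(LINT s:A|M. h s *\<^sub>R f s) = (LINT s:A|N. f s)"
    unfolding set_lebesgue_integral_def N comm integral_density[OF g hm h0] ..
qed

section \<open>Disintegration along a kernel\<close>

lemma borel_measurable_nn_integral_kernel:
  fixes J :: "'s \<Rightarrow> 'a measure" and f :: "'a \<Rightarrow> ennreal"
  assumes J: "\<And>s. sets (J s) = sets N"
    and meas: "\<And>B. B \<in> sets N \<Longrightarrow> (\<lambda>s. emeasure (J s) B) \<in> borel_measurable M"
    and f: "f \<in> borel_measurable N"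
  shows "(\<lambda>s. \<integral>\<^sup>+x. f x \<partial>J s) \<in> borel_measurable M"
proof -
  have bm: "borel_measurable (J s) = borel_measurable N" for s
    by (rule measurable_cong_sets[OF J refl])
  have sp: "space (J s) = space N" for s
    by (rule sets_eq_imp_space_eq[OF J])
  show ?thesis
    using f
  proof (induction rule: borel_measurable_induct)
    case (cong f g)
    then have "(\<integral>\<^sup>+x. f x \<partial>J s) = (\<integral>\<^sup>+x. g x \<partial>J s)" for s
      by (intro nn_integral_cong) (simp add: sp)
    with cong show ?case by simp
  next
    case (set B)
    then show ?case by (simp add: J meas)
  next
    case (mult u c)
    then show ?case by (simp add: nn_integral_cmult bm)
  next
    case (add u v)
    then show ?case by (simp add: nn_integral_add bm)
  next
    case (seq U)
    then have "(\<integral>\<^sup>+x. (SUP i. U i) x \<partial>J s) = (SUP i. \<integral>\<^sup>+x. U i x \<partial>J s)" for s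
      by (simp add: image_comp nn_integral_monotone_convergence_SUP bm)
    with seq show ?case by simp
  qed
qed

text \<open>Integrability turns each Bochner integral of \<open>g \<ge> 0\<close> into a finite non-negative integral,
  and in that form the claim is the hypothesis on \<open>m\<close>. Measurability in \<open>s\<close> is inherited from
  the non-negative integrals in the same way.\<close>

lemma kernel_disintegration_nonneg:
  fixes J :: "real \<Rightarrow> 'a::topological_space measure" and g :: "'a \<Rightarrow> real"
  assumes F: "sets F = sets borel" and A: "A \<in> sets borel"
    and J: "\<And>s. sets (J s) = sets borel"
    and J_meas: "\<And>B. B \<in> sets borel \<Longrightarrow> (\<lambda>s. emeasure (J s) B) \<in> borel_measurable borel"
    and dis: "\<And>f::'a \<Rightarrow> ennreal. f \<in> borel_measurable borel \<Longrightarrow>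
          (\<integral>\<^sup>+x. f x \<partial>m) = (\<integral>\<^sup>+s\<in>A. (\<integral>\<^sup>+x. f x \<partial>J s) \<partial>F)"
    and g: "g \<in> borel_measurable borel" and g0: "\<And>x. 0 \<le> g x"
    and int_m: "integrable m g" and int_J: "\<And>s. integrable (J s) g"
  shows "(\<lambda>s. LINT x|J s. g x) \<in> borel_measurable borel"
    and "has_bochner_integral F (\<lambda>s. indicator A s *\<^sub>R (LINT x|J s. g x)) (LINT x|m. g x)"
proof -
  define u where "u s = (LINT x|J s. g x)" for s
  have u0: "0 \<le> u s" for s
    by (simp add: u_def g0)
  have u_eq: "ennreal (u s) = (\<integral>\<^sup>+x. ennreal (g x) \<partial>J s)" for s
    unfolding u_def by (rule nn_integral_eq_integral[symmetric]) (use int_J g0 in auto)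
  have "(\<lambda>s. \<integral>\<^sup>+x. ennreal (g x) \<partial>J s) \<in> borel_measurable borel"
    by (rule borel_measurable_nn_integral_kernel[where N=borel]) (use J J_meas g in auto)
  then have "(\<lambda>s. enn2real (ennreal (u s))) \<in> borel_measurable borel"
    unfolding u_eq by measurable
  then show u_meas: "(\<lambda>s. LINT x|J s. g x) \<in> borel_measurable borel"
    using u0 by (simp add: u_def)
  have "(\<integral>\<^sup>+s. ennreal (indicator A s *\<^sub>R u s) \<partial>F) = (\<integral>\<^sup>+s\<in>A. ennreal (u s) \<partial>F)"
    by (intro nn_integral_cong) (auto simp: indicator_def)
  also have "\<dots> = (\<integral>\<^sup>+x. ennreal (g x) \<partial>m)"
    unfolding u_eq by (rule dis[symmetric]) (use g in measurable)
  also have "\<dots> = ennreal (LINT x|m. g x)"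
    by (rule nn_integral_eq_integral) (use int_m g0 in auto)
  finally have nn: "(\<integral>\<^sup>+s. ennreal (indicator A s *\<^sub>R u s) \<partial>F) = ennreal (LINT x|m. g x)" .
  have "(\<lambda>s. indicator A s *\<^sub>R u s) \<in> borel_measurable F"
    using u_meas A by (simp add: measurable_cong_sets[OF F refl] u_def)
  then have "has_bochner_integral F (\<lambda>s. indicator A s *\<^sub>R u s) (LINT x|m. g x)"
    by (rule has_bochner_integral_nn_integral[OF _ _ _ nn]) (simp_all add: u0 g0)
  then show "has_bochner_integral F (\<lambda>s. indicator A s *\<^sub>R (LINT x|J s. g x)) (LINT x|m. g x)"
    by (simp add: u_def)
qed

lemma kernel_disintegration_real:
  fixes J :: "real \<Rightarrow> 'a::topological_space measure" and g :: "'a \<Rightarrow> real"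
  assumes F: "sets F = sets borel" and A: "A \<in> sets borel"
    and J: "\<And>s. sets (J s) = sets borel"
    and J_meas: "\<And>B. B \<in> sets borel \<Longrightarrow> (\<lambda>s. emeasure (J s) B) \<in> borel_measurable borel"
    and dis: "\<And>f::'a \<Rightarrow> ennreal. f \<in> borel_measurable borel \<Longrightarrow>
          (\<integral>\<^sup>+x. f x \<partial>m) = (\<integral>\<^sup>+s\<in>A. (\<integral>\<^sup>+x. f x \<partial>J s) \<partial>F)"
    and g: "g \<in> borel_measurable borel"
    and int_m: "integrable m g" and int_J: "\<And>s. integrable (J s) g"
  shows "(\<lambda>s. LINT x|J s. g x) \<in> borel_measurable borel"
    and "has_bochner_integral F (\<lambda>s. indicator A s *\<^sub>R (LINT x|J s. g x)) (LINT x|m. g x)"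
proof -
  define p n where "p x = max 0 (g x)" and "n x = max 0 (- g x)" for x
  have g_eq: "g = (\<lambda>x. p x - n x)"
    by (auto simp: p_def n_def max_def)
  have int: "integrable M p" "integrable M n" if "integrable M g" for M
    using that unfolding p_def n_def by auto
  have "p \<in> borel_measurable borel" "n \<in> borel_measurable borel"
    using g unfolding p_def n_def by measurable
  note P = kernel_disintegration_nonneg[where J=J, OF F A J J_meas dis this(1)]
    and N = kernel_disintegration_nonneg[where J=J, OF F A J J_meas dis this(2)]
  have p0: "0 \<le> p x" and n0: "0 \<le> n x" for x
    by (auto simp: p_def n_def)
  have diff: "(LINT x|M. g x) = (LINT x|M. p x) - (LINT x|M. n x)" if "integrable M g" for M
    unfolding g_eq using int[OF that] by (rule Bochner_Integration.integral_diff)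
  show "(\<lambda>s. LINT x|J s. g x) \<in> borel_measurable borel"
    unfolding diff[OF int_J]
    by (intro borel_measurable_diff P(1) N(1) p0 n0 int int_m int_J)
  show "has_bochner_integral F (\<lambda>s. indicator A s *\<^sub>R (LINT x|J s. g x)) (LINT x|m. g x)"
    unfolding diff[OF int_J] diff[OF int_m] scaleR_diff_right
    by (intro has_bochner_integral_diff P(2) N(2) p0 n0 int int_m int_J)
qed

lemma kernel_disintegration_complex:
  fixes J :: "real \<Rightarrow> 'a::topological_space measure" and g :: "'a \<Rightarrow> complex"
  assumes F: "sets F = sets borel" and A: "A \<in> sets borel"
    and J: "\<And>s. sets (J s) = sets borel"
    and J_meas: "\<And>B. B \<in> sets borel \<Longrightarrow> (\<lambda>s. emeasure (J s) B) \<in> borel_measurable borel"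
    and dis: "\<And>f::'a \<Rightarrow> ennreal. f \<in> borel_measurable borel \<Longrightarrow>
          (\<integral>\<^sup>+x. f x \<partial>m) = (\<integral>\<^sup>+s\<in>A. (\<integral>\<^sup>+x. f x \<partial>J s) \<partial>F)"
    and g: "g \<in> borel_measurable borel"
    and int_m: "integrable m g" and int_J: "\<And>s. integrable (J s) g"
  shows "(\<lambda>s. CLINT x|J s. g x) \<in> borel_measurable borel"
    and "set_integrable F A (\<lambda>s. CLINT x|J s. g x)"
    and "(CLINT s:A|F. CLINT x|J s. g x) = (CLINT x|m. g x)"
proof -
  have "(\<lambda>x. Re (g x)) \<in> borel_measurable borel" "(\<lambda>x. Im (g x)) \<in> borel_measurable borel"
    using g by measurable
  note R = kernel_disintegration_real[where J=J, OF F A J J_meas dis this(1)]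
    and I = kernel_disintegration_real[where J=J, OF F A J J_meas dis this(2)]
  have split: "(CLINT x|M. g x) =
      of_real (LINT x|M. Re (g x)) + \<i> * of_real (LINT x|M. Im (g x))" if "integrable M g" for M
    using that by (simp add: complex_eq_iff)
  have ind: "indicator A s *\<^sub>R (complex_of_real x + \<i> * complex_of_real y)
      = of_real (indicator A s *\<^sub>R x) + \<i> * of_real (indicator A s *\<^sub>R y)" for s x y
    by (simp add: scaleR_conv_of_real algebra_simps)
  show "(\<lambda>s. CLINT x|J s. g x) \<in> borel_measurable borel"
    unfolding split[OF int_J]
    by (intro borel_measurable_add borel_measurable_times borel_measurable_const
        measurable_compose[OF R(1)] measurable_compose[OF I(1)] integrable_Re integrable_Im
        int_m int_J) simp_all
  have "has_bochner_integral F (\<lambda>s. indicator A s *\<^sub>R (CLINT x|J s. g x)) (CLINT x|m. g x)"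
    unfolding split[OF int_J] split[OF int_m] ind
    by (intro has_bochner_integral_add has_bochner_integral_mult_right
        has_bochner_integral_of_real R(2) I(2) integrable_Re integrable_Im int_m int_J)
  then show "set_integrable F A (\<lambda>s. CLINT x|J s. g x)"
    and "(CLINT s:A|F. CLINT x|J s. g x) = (CLINT x|m. g x)"
    by (auto simp: set_integrable_def set_lebesgue_integral_def has_bochner_integral_iff)
qed

text \<open>Tested on indicator functions, the disintegration says that the set function inside
  \<^const>\<open>kernel_integral\<close> is that of \<open>m\<close>. In particular it is countably additive, so
  \<^const>\<open>measure_of\<close> returns it and not the default zero measure.\<close>

lemma kernel_integral_eq:
  fixes J :: "real \<Rightarrow> 'a::topological_space measure"
  assumes h: "is_RN_deriv M F h" and M: "sets M = sets borel" and A: "A \<in> sets borel"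
    and m: "sets m = sets borel"
    and J: "\<And>s. sets (J s) = sets borel"
    and J_meas: "\<And>B. B \<in> sets borel \<Longrightarrow> (\<lambda>s. emeasure (J s) B) \<in> borel_measurable borel"
    and dis: "\<And>f::'a \<Rightarrow> ennreal. f \<in> borel_measurable borel \<Longrightarrow>
          (\<integral>\<^sup>+x. f x \<partial>m) = (\<integral>\<^sup>+s\<in>A. (\<integral>\<^sup>+x. f x \<partial>J s) \<partial>F)"
  shows "kernel_integral M A h J = m"
proof -
  have F: "F = density M (\<lambda>s. ennreal (h s))" and hm: "(\<lambda>s. ennreal (h s)) \<in> borel_measurable M"
    using h M by (auto simp: is_RN_deriv_def cong: measurable_cong_sets)
  have eq: "(\<integral>\<^sup>+s\<in>A. ennreal (h s) * emeasure (J s) B \<partial>M) = emeasure m B"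
    if B: "B \<in> sets borel" for B
  proof -
    have JB: "(\<lambda>s. emeasure (J s) B * indicator A s) \<in> borel_measurable M"
      using J_meas[OF B] A by (simp add: measurable_cong_sets[OF M refl])
    have "emeasure m B = (\<integral>\<^sup>+s\<in>A. emeasure (J s) B \<partial>F)"
      using dis[of "indicator B"] B by (simp add: m J)
    also have "\<dots> = (\<integral>\<^sup>+s\<in>A. ennreal (h s) * emeasure (J s) B \<partial>M)"
      unfolding F nn_integral_density[OF hm JB] by (simp add: mult.assoc)
    finally show ?thesis ..
  qed
  have sp: "space m = UNIV"
    using sets_eq_imp_space_eq[OF m] by simp
  have "kernel_integral M A h J = measure_of UNIV (sets borel) (emeasure m)"
    unfolding kernel_integral_def
    by (rule measure_of_eq) (auto simp: eq sets.sigma_sets_eq[of borel, simplified])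
  then show ?thesis
    using measure_of_of_measure[of m] by (simp add: sp m)
qed

section \<open>The integrand of the jump part\<close>

lemma borel_measurable_levy_integrand:
  "levy_integrand (\<xi>::'a::{real_inner, second_countable_topology}) \<in> borel_measurable borel"
  unfolding levy_integrand_def by measurable

text \<open>Near the origin the second-order remainder of the exponential is at most \<open>\<langle>\<xi>, x\<rangle>\<^sup>2 / 2\<close>, and
  replacing \<open>\<langle>\<xi>, x\<rangle>\<close> by \<open>\<langle>\<xi>, x\<rangle> / (1 + |x|\<^sup>2)\<close> costs a term of third order. Away from the origin
  all terms are bounded, because \<open>|x| \<le> 1 + |x|\<^sup>2\<close>.\<close>

lemma norm_levy_integrand_le:
  fixes \<xi> x :: "'a::real_inner"
  shows "norm (levy_integrand \<xi> x) \<le> (2 + norm \<xi> + (norm \<xi>)\<^sup>2) * min 1 ((norm x)\<^sup>2)"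
proof -
  define u where "u = \<xi> \<bullet> x"
  define r where "r = norm x"
  define k where "k = norm \<xi>"
  have r: "0 \<le> r" and k: "0 \<le> k" and u: "\<bar>u\<bar> \<le> k * r"
    unfolding u_def r_def k_def by (auto intro: Cauchy_Schwarz_ineq2)
  have pos: "0 < 1 + r\<^sup>2"
    by (simp add: add_pos_nonneg)
  have L: "levy_integrand \<xi> x = iexp u - 1 - \<i> * of_real (u / (1 + r\<^sup>2))"
    by (simp add: levy_integrand_def u_def r_def)
  show ?thesis
  proof (cases "r \<le> 1")
    case True
    have "\<bar>u\<bar> * r\<^sup>2 / (1 + r\<^sup>2) \<le> k * r\<^sup>2"
    proof -
      have "\<bar>u\<bar> * r\<^sup>2 \<le> k * r\<^sup>2"
        using u mult_left_le[OF True k] by (intro mult_right_mono) simp_all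
      also have "\<dots> \<le> k * r\<^sup>2 * (1 + r\<^sup>2)"
        using k by (simp add: distrib_left)
      finally show ?thesis
        using pos by (simp add: divide_le_eq)
    qed
    moreover have "norm (iexp u - 1 - \<i> * of_real u) \<le> u\<^sup>2"
    proof -
      have "norm (iexp u - (\<Sum>j\<le>1. (\<i> * of_real u) ^ j / fact j)) \<le> \<bar>u\<bar> ^ Suc 1 / fact (Suc 1)"
        by (rule iexp_approx1)
      moreover have "iexp u - (\<Sum>j\<le>1. (\<i> * of_real u) ^ j / fact j) = iexp u - 1 - \<i> * of_real u"
        by (simp add: diff_diff_eq)
      ultimately have "norm (iexp u - 1 - \<i> * of_real u) \<le> u\<^sup>2 / 2"
        by (simp only:) (simp add: power2_eq_square)
      then show ?thesis
        using zero_le_power2[of u] by linarith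
    qed
    moreover have "u\<^sup>2 \<le> k\<^sup>2 * r\<^sup>2"
      using power_mono[OF u abs_ge_zero, of 2] by (simp add: power_mult_distrib)
    moreover have "norm (levy_integrand \<xi> x)
        \<le> norm (iexp u - 1 - \<i> * of_real u) + \<bar>u\<bar> * r\<^sup>2 / (1 + r\<^sup>2)"
    proof -
      have ur: "u - u / (1 + r\<^sup>2) = u * r\<^sup>2 / (1 + r\<^sup>2)"
        using pos by (simp add: field_simps)
      have "levy_integrand \<xi> x
          = (iexp u - 1 - \<i> * of_real u) + \<i> * of_real (u * r\<^sup>2 / (1 + r\<^sup>2))"
        unfolding L ur[symmetric] by (simp add: algebra_simps)
      moreover have "norm (\<i> * complex_of_real (u * r\<^sup>2 / (1 + r\<^sup>2))) = \<bar>u\<bar> * r\<^sup>2 / (1 + r\<^sup>2)"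
        unfolding norm_mult norm_of_real using pos by (simp add: abs_mult)
      ultimately show ?thesis
        using norm_triangle_ineq[of "iexp u - 1 - \<i> * of_real u"
            "\<i> * complex_of_real (u * r\<^sup>2 / (1 + r\<^sup>2))"] by (simp only:)
    qed
    ultimately have "norm (levy_integrand \<xi> x) \<le> (k + k\<^sup>2) * r\<^sup>2"
      by (simp add: algebra_simps)
    also have "\<dots> \<le> (2 + k + k\<^sup>2) * r\<^sup>2"
      by (intro mult_right_mono) auto
    also have "r\<^sup>2 = min 1 (r\<^sup>2)"
      using True r by (simp add: power_le_one min_absorb2)
    finally show ?thesis
      by (simp add: r_def k_def)
  next
    case False
    have "r \<le> 1 + r\<^sup>2"
      using self_le_power[of r 2] False by linarith
    then have "k * r \<le> k * (1 + r\<^sup>2)"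
      using k by (rule mult_left_mono)
    with u have "\<bar>u\<bar> / (1 + r\<^sup>2) \<le> k"
      using pos by (simp add: divide_le_eq)
    moreover have "norm (\<i> * complex_of_real (u / (1 + r\<^sup>2))) = \<bar>u\<bar> / (1 + r\<^sup>2)"
      unfolding norm_mult norm_of_real using pos by simp
    moreover have "norm (iexp u - 1 - \<i> * of_real (u / (1 + r\<^sup>2)))
        \<le> norm (iexp u) + norm (1::complex) + norm (\<i> * complex_of_real (u / (1 + r\<^sup>2)))"
      by (rule order_trans[OF norm_triangle_ineq4 add_right_mono[OF norm_triangle_ineq4]])
    ultimately have "norm (levy_integrand \<xi> x) \<le> 2 + k"
      unfolding L by simp
    also have "\<dots> \<le> (2 + k + k\<^sup>2) * min 1 (r\<^sup>2)"
      using False by (simp add: min_absorb1)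
    finally show ?thesis
      by (simp add: r_def k_def)
  qed
qed

lemma integrable_levy_integrand:
  fixes \<xi> :: "'a::{real_inner, second_countable_topology}"
  assumes m: "levy_measure m"
  shows "integrable m (levy_integrand \<xi>)"
proof (rule Bochner_Integration.integrable_bound)
  have sets: "sets m = sets borel"
    using m by (simp add: levy_measure_def)
  have "integrable m (\<lambda>x. min 1 ((norm x)\<^sup>2))"
  proof (rule integrableI_nonneg)
    show "(\<lambda>x. min 1 ((norm x)\<^sup>2)) \<in> borel_measurable m"
      unfolding measurable_cong_sets[OF sets refl] by measurable
  qed (use m in \<open>auto simp: levy_measure_def\<close>)
  then show "integrable m (\<lambda>x. (2 + norm \<xi> + (norm \<xi>)\<^sup>2) * min 1 ((norm x)\<^sup>2))"
    by simp
  show "levy_integrand \<xi> \<in> borel_measurable m"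
    unfolding measurable_cong_sets[OF sets refl] by (rule borel_measurable_levy_integrand)
  show "AE x in m. norm (levy_integrand \<xi> x)
      \<le> norm ((2 + norm \<xi> + (norm \<xi>)\<^sup>2) * min 1 ((norm x)\<^sup>2))"
    unfolding real_norm_def
    by (intro AE_I2 order_trans[OF norm_levy_integrand_le abs_ge_self])
qed

text \<open>Removing the origin from the domain of integration has no effect, because the integrand
  vanishes there.\<close>

lemma set_integral_levy_integrand:
  "(CLINT x:- {0}|M. levy_integrand \<xi> x * of_real c) = c *\<^sub>R (CLINT x|M. levy_integrand \<xi> x)"
proof -
  have "indicator (- {0}) x *\<^sub>R (levy_integrand \<xi> x * of_real c)
      = levy_integrand \<xi> x * of_real c" for x
    by (cases "x = 0") (simp_all add: levy_integrand_def)
  then show ?thesis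
    unfolding set_lebesgue_integral_def by (simp only:) (simp add: scaleR_conv_of_real mult.commute)
qed

section \<open>The factorization\<close>

theorem theorem3p53:
  fixes I :: "nat set"
    and e :: "nat \<Rightarrow> 'a::{real_inner, banach, second_countable_topology}"
    and \<mu> :: "real \<Rightarrow> real \<Rightarrow> 'a measure"
    and a_ts :: "real \<Rightarrow> real \<Rightarrow> 'a"
    and R_ts :: "real \<Rightarrow> real \<Rightarrow> 'a \<Rightarrow> 'a"
    and m_ts :: "real \<Rightarrow> real \<Rightarrow> 'a measure"
    and a :: "real set \<Rightarrow> 'a"
    and R :: "real set \<Rightarrow> 'a \<Rightarrow> 'a"
    and m :: "real set \<Rightarrow> 'a measure"
    and \<mu>\<^sub>A :: "real set \<Rightarrow> 'a measure"
    and \<gamma> \<pi>\<^sub>R F \<pi> :: "real measure"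
    and b :: "real \<Rightarrow> 'a"
    and K :: "real \<Rightarrow> 'a \<Rightarrow> 'a"
    and J :: "real \<Rightarrow> 'a measure"
    and h1 h2 h3 :: "real \<Rightarrow> real"
  assumes basis: "orthonormal_basis I e"
    and prob: "\<And>t s. s \<le> t \<Longrightarrow> borel_prob (\<mu> t s)"
    and conv: "\<And>t r s. s \<le> r \<Longrightarrow> r \<le> t \<Longrightarrow> \<mu> t s = hconv (\<mu> t r) (\<mu> r s)"
    and cont_t: "\<And>s. weakly_converges (\<lambda>t. \<mu> t s) (return borel 0) (at_right s)"
    and cont_s: "\<And>t. weakly_converges (\<lambda>s. \<mu> t s) (return borel 0) (at_left t)"
    and triplet_ts: "\<And>t s. s \<le> t \<Longrightarrow> has_triplet (\<mu> t s) (a_ts t s) (R_ts t s) (m_ts t s)"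
    and natural: "\<And>\<xi> t c d. c \<le> d \<Longrightarrow> d \<le> t \<Longrightarrow> bounded_variation_on (\<lambda>s. a_ts t s \<bullet> \<xi>) c d"
    and a_add: "\<And>\<xi>. loc_countably_additive (\<lambda>A. a A \<bullet> \<xi>)"
    and R_op: "\<And>A. bounded_borel A \<Longrightarrow> nonneg_trace_class (R A)"
    and R_add: "\<And>\<xi>. loc_countably_additive (\<lambda>A. R A \<xi> \<bullet> \<xi>)"
    and m_levy: "\<And>A. bounded_borel A \<Longrightarrow> levy_measure (m A)"
    and m_add: "\<And>B. B \<in> sets borel \<Longrightarrow> loc_countably_additive (\<lambda>A. emeasure (m A) B)"
    and on_intervals: "\<And>t s. s \<le> t \<Longrightarrow>
          a {s<..t} = a_ts t s \<and> R {s<..t} = R_ts t s \<and> m {s<..t} = m_ts t s"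
    and \<gamma>_finite: "\<And>A. bounded_borel A \<Longrightarrow> gamma_fun I e a A < \<infinity>"
    and \<mu>\<^sub>A: "\<And>A. bounded_borel A \<Longrightarrow> has_triplet (\<mu>\<^sub>A A) (a A) (R A) (m A)"
    and \<gamma>: "\<gamma> = gamma_measure I e a"
    and \<pi>\<^sub>R: "\<pi>\<^sub>R = piR_measure I e R"
    and F: "F = F_measure m"
    and \<pi>: "\<pi> = add_measures3 \<gamma> \<pi>\<^sub>R F"
    and K_op: "\<And>s. nonneg_trace_class (K s)"
    and K_meas: "\<And>\<xi>. (\<lambda>s. K s \<xi>) \<in> borel_measurable borel"
    and K: "\<And>A \<xi>. bounded_borel A \<Longrightarrow>
          set_integrable \<pi>\<^sub>R A (\<lambda>s. K s \<xi>) \<and> R A \<xi> = (LINT s:A|\<pi>\<^sub>R. K s \<xi>)"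
    and J_levy: "\<And>s. levy_measure (J s)"
    and J_meas: "\<And>B. B \<in> sets borel \<Longrightarrow> (\<lambda>s. emeasure (J s) B) \<in> borel_measurable borel"
    and J: "\<And>A (f::'a \<Rightarrow> ennreal). bounded_borel A \<Longrightarrow> f \<in> borel_measurable borel \<Longrightarrow>
          (\<integral>\<^sup>+x. f x \<partial>m A) = (\<integral>\<^sup>+s\<in>A. (\<integral>\<^sup>+x. f x \<partial>J s) \<partial>F)"
    and b_meas: "b \<in> borel_measurable borel"
    and b: "\<And>A. bounded_borel A \<Longrightarrow> set_integrable \<gamma> A b \<and> a A = (LINT s:A|\<gamma>. b s)"
    and h1: "is_RN_deriv \<pi> \<gamma> h1"
    and h2: "is_RN_deriv \<pi> \<pi>\<^sub>R h2"
    and h3: "is_RN_deriv \<pi> F h3"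
  shows "(\<forall>A. bounded_borel A \<longrightarrow>
            (\<forall>\<xi>. set_integrable \<pi> A (\<lambda>s. rho b K J h1 h2 h3 s \<xi>) \<and>
               char_fun (\<mu>\<^sub>A A) \<xi> = exp (- levy_exponent (a A) (R A) (m A) \<xi>) \<and>
               exp (- levy_exponent (a A) (R A) (m A) \<xi>)
                 = exp (- (CLINT s:A|\<pi>. rho b K J h1 h2 h3 s \<xi>))) \<and>
            set_integrable \<pi> A (\<lambda>s. h1 s *\<^sub>R b s) \<and>
            (\<forall>\<xi>. set_integrable \<pi> A (\<lambda>s. h2 s *\<^sub>R K s \<xi>)) \<and>
            has_triplet (\<mu>\<^sub>A A)
              (LINT s:A|\<pi>. h1 s *\<^sub>R b s)
              (\<lambda>\<xi>. LINT s:A|\<pi>. h2 s *\<^sub>R K s \<xi>)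
              (kernel_integral \<pi> A h3 J)) \<and>
         (\<forall>s t. s \<le> t \<longrightarrow>
            (\<forall>\<xi>. char_fun (\<mu> t s) \<xi> = exp (- (CLINT r:{s<..t}|\<pi>. rho b K J h1 h2 h3 r \<xi>))) \<and>
            has_triplet (\<mu> t s)
              (LINT r:{s<..t}|\<pi>. h1 r *\<^sub>R b r)
              (\<lambda>\<xi>. LINT r:{s<..t}|\<pi>. h2 r *\<^sub>R K r \<xi>)
              (kernel_integral \<pi> {s<..t} h3 J))"
proof -
  have sets_\<pi>: "sets \<pi> = sets borel"
    by (simp add: \<pi> sets_add_measures3)
  have sets_F: "sets F = sets borel"
    using h3 sets_\<pi> by (metis is_RN_deriv_def sets_density)
  have sets_J: "sets (J s) = sets borel" for s
    using J_levy by (simp add: levy_measure_def)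

  have drift: "set_integrable \<pi> A (\<lambda>s. h1 s *\<^sub>R b s)" "(LINT s:A|\<pi>. h1 s *\<^sub>R b s) = a A"
    if "bounded_borel A" for A
    using set_integral_RN_deriv[OF h1 sets_\<pi> _ b_meas] b[OF that] that
    by (auto simp: bounded_borel_def)
  have gauss: "set_integrable \<pi> A (\<lambda>s. h2 s *\<^sub>R K s \<xi>)" "(LINT s:A|\<pi>. h2 s *\<^sub>R K s \<xi>) = R A \<xi>"
    if "bounded_borel A" for A \<xi>
    using set_integral_RN_deriv[OF h2 sets_\<pi> _ K_meas] K[OF that] that
    by (auto simp: bounded_borel_def)
  have jump: "set_integrable \<pi> A (\<lambda>s. h3 s *\<^sub>R (CLINT x|J s. levy_integrand \<xi> x))"
      "(CLINT s:A|\<pi>. h3 s *\<^sub>R (CLINT x|J s. levy_integrand \<xi> x)) = (CLINT x|m A. levy_integrand \<xi> x)"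
    if A: "bounded_borel A" for A \<xi>
  proof -
    have A': "A \<in> sets borel"
      using A by (simp add: bounded_borel_def)
    have dis: "(\<lambda>s. CLINT x|J s. levy_integrand \<xi> x) \<in> borel_measurable borel"
      "set_integrable F A (\<lambda>s. CLINT x|J s. levy_integrand \<xi> x)"
      "(CLINT s:A|F. CLINT x|J s. levy_integrand \<xi> x) = (CLINT x|m A. levy_integrand \<xi> x)"
      by (rule kernel_disintegration_complex[OF sets_F A'];
          fact sets_J J_meas J[OF A] borel_measurable_levy_integrand
            integrable_levy_integrand[OF m_levy[OF A]] integrable_levy_integrand[OF J_levy])+
    show "set_integrable \<pi> A (\<lambda>s. h3 s *\<^sub>R (CLINT x|J s. levy_integrand \<xi> x))"
      by (rule set_integral_RN_deriv(1)[OF h3 sets_\<pi> A' dis(1,2)])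
    show "(CLINT s:A|\<pi>. h3 s *\<^sub>R (CLINT x|J s. levy_integrand \<xi> x))
        = (CLINT x|m A. levy_integrand \<xi> x)"
      using set_integral_RN_deriv(2)[OF h3 sets_\<pi> A' dis(1,2)] dis(3) by (rule trans)
  qed
  have measure: "kernel_integral \<pi> A h3 J = m A" if A: "bounded_borel A" for A
    using A m_levy[OF A]
    by (intro kernel_integral_eq[OF h3 sets_\<pi> _ _ sets_J J_meas J])
      (auto simp: bounded_borel_def levy_measure_def)

  have rho: "set_integrable \<pi> A (\<lambda>s. rho b K J h1 h2 h3 s \<xi>)"
      "(CLINT s:A|\<pi>. rho b K J h1 h2 h3 s \<xi>) = levy_exponent (a A) (R A) (m A) \<xi>"
    if A: "bounded_borel A" for A \<xi>
  proof -
    \<comment> \<open>The indicator is moved inside the pairings with \<open>\<xi>\<close>, so that these act on the vector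
      integrands whose integrals over \<open>A\<close> are \<open>a A\<close> and \<open>R A \<xi>\<close>.\<close>
    have ind: "indicator A s *\<^sub>R rho b K J h1 h2 h3 s \<xi> =
        - \<i> * of_real ((indicator A s *\<^sub>R h1 s *\<^sub>R b s) \<bullet> \<xi>)
        + of_real ((indicator A s *\<^sub>R h2 s *\<^sub>R K s \<xi>) \<bullet> \<xi>) / 2
        - indicator A s *\<^sub>R h3 s *\<^sub>R (CLINT x|J s. levy_integrand \<xi> x)" for s
      unfolding rho_def set_integral_levy_integrand by (simp add: indicator_def)
    have "has_bochner_integral \<pi> (\<lambda>s. indicator A s *\<^sub>R rho b K J h1 h2 h3 s \<xi>)
        (levy_exponent (a A) (R A) (m A) \<xi>)"
      unfolding ind levy_exponent_def
      using drift[OF A] gauss[OF A] jump[OF A]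
      by (intro has_bochner_integral_diff has_bochner_integral_add has_bochner_integral_mult_right
          has_bochner_integral_divide_zero has_bochner_integral_of_real
          has_bochner_integral_inner_left)
        (simp_all add: set_integrable_def set_lebesgue_integral_def has_bochner_integral_iff)
    then show "set_integrable \<pi> A (\<lambda>s. rho b K J h1 h2 h3 s \<xi>)"
      "(CLINT s:A|\<pi>. rho b K J h1 h2 h3 s \<xi>) = levy_exponent (a A) (R A) (m A) \<xi>"
      by (simp_all add: set_integrable_def set_lebesgue_integral_def has_bochner_integral_iff)
  qed

  have interval: "bounded_borel {s<..t}" for s t :: real
    by (simp add: bounded_borel_def)
  have triplet_interval: "has_triplet (\<mu> t s) (a {s<..t}) (R {s<..t}) (m {s<..t})"
    if "s \<le> t" for s t
    using triplet_ts[OF that] on_intervals[OF that] by simp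
  show ?thesis
    using \<mu>\<^sub>A triplet_interval interval
    by (auto simp: drift gauss measure rho has_triplet_def)
qed

end
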